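(* Let $M$ be a complete noncompact Riemannian manifold and let $\omega$ be a smooth differential form on $M$ which has $2$-moderate growth for $q=2$, i.e. there are $x_0\in M$ and a function $\psi\in\mathcal F$ such that $$\limsup_{r\to\infty}\frac1{r^2\psi(r)}\int_{B(x_0;r)}|\omega|^2\,dv<\infty ,$$ and suppose that this holds with some $\psi\in\mathcal F$ satisfying, for some $\lambda>2$, $$\lim_{\rho\to\infty}\frac{\psi(\rho)}{\rho^{\lambda-2}}<\infty .$$ Then $$\int_{B(x_0;\rho)}\frac{|\omega|^2}{2}\,dv=o(\rho^\lambda)\quad\text{as }\rho\to\infty .$$ In particular, if $\omega$ has $2$-moderate growth for $q=2$ with some continuous, monotone decreasing function $\psi>0$ in $\mathcal F$, then $\int_{B(x_0;\rho)}\frac{|\omega|^2}{2}\,dv=o(\rho^\lambda)$ as $\rho\to\infty$ (where $\lambda>2$).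
   Context: $B(x_0;r)$ is the geodesic ball of radius $r$ centered at $x_0$, $dv$ the volume element of $M$, and $|\cdot|$ the pointwise norm on forms. $\mathcal F$ is the set of functions $\psi:[a,\infty)\to(0,\infty)$ with $\int_a^\infty\frac{dr}{r\psi(r)}=\infty$ for some $a\ge 0$ (functions in $\mathcal F$ are not necessarily monotone).
   Formalization: The condition ∫_a^∞ dr/(rψ(r)) = ∞ defining 𝓕 is read as divergence at infinity (every tail integral infinite, ψ measurable); otherwise a = 0, ψ = max(1, r^{λ-2}) would lie in 𝓕 and the claim would fail. *)

theory Defs
  imports "HOL-Analysis.Analysis" "HOL-Library.Landau_Symbols"
begin

section \<open>Smooth maps between Euclidean spaces\<close>

text \<open>Both notions are meant for open sets \<open>S\<close>. Ranging over all directions \<open>v\<close> at every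
  order yields continuity of all iterated partial derivatives.\<close>

primrec Ck_on :: "nat \<Rightarrow> ('a::euclidean_space \<Rightarrow> 'b::real_normed_vector) \<Rightarrow> 'a set \<Rightarrow> bool" where
  "Ck_on 0 f S \<longleftrightarrow> continuous_on S f"
| "Ck_on (Suc k) f S \<longleftrightarrow>
     (\<forall>x\<in>S. f differentiable (at x)) \<and> (\<forall>v. Ck_on k (\<lambda>x. frechet_derivative f (at x) v) S)"

definition smooth_on :: "'a::euclidean_space set \<Rightarrow> ('a \<Rightarrow> 'b::real_normed_vector) \<Rightarrow> bool" where
  "smooth_on S f \<longleftrightarrow> (\<forall>k. Ck_on k f S)"


section \<open>Smooth manifolds\<close>

text \<open>The underlying space of the manifold is a whole type \<open>'m\<close>, with its Hausdorff, second
  countable topology; the dimension is \<open>CARD('n)\<close>. A chart is a pair of its domain and its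
  coordinate map (whose values off the domain are irrelevant). An atlas need not be maximal.\<close>

type_synonym ('m, 'n) chart = "'m set \<times> ('m \<Rightarrow> real^'n)"

abbreviation chart_dom :: "('m, 'n::finite) chart \<Rightarrow> 'm set" where
  "chart_dom c \<equiv> fst c"

abbreviation chart_map :: "('m, 'n::finite) chart \<Rightarrow> 'm \<Rightarrow> real^'n" where
  "chart_map c \<equiv> snd c"

definition chart_inv :: "('m, 'n::finite) chart \<Rightarrow> real^'n \<Rightarrow> 'm" where
  "chart_inv c = inv_into (chart_dom c) (chart_map c)"

definition transition :: "('m, 'n::finite) chart \<Rightarrow> ('m, 'n) chart \<Rightarrow> real^'n \<Rightarrow> real^'n" where
  "transition c d = chart_map d \<circ> chart_inv c"

definition smooth_atlas ::
  "('m::{second_countable_topology,t2_space}, 'n::finite) chart set \<Rightarrow> bool" where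
  "smooth_atlas A \<longleftrightarrow>
     (\<Union>c\<in>A. chart_dom c) = UNIV \<and>
     (\<forall>c\<in>A. open (chart_dom c) \<and> open (chart_map c ` chart_dom c) \<and>
        homeomorphism (chart_dom c) (chart_map c ` chart_dom c) (chart_map c) (chart_inv c)) \<and>
     (\<forall>c\<in>A. \<forall>d\<in>A. smooth_on (chart_map c ` (chart_dom c \<inter> chart_dom d)) (transition c d))"

definition jacobian ::
  "('m, 'n::finite) chart \<Rightarrow> ('m, 'n) chart \<Rightarrow> 'm \<Rightarrow> real^'n^'n" where
  "jacobian c d p = matrix (frechet_derivative (transition c d) (at (chart_map c p)))"

text \<open>An arbitrary chart around \<open>p\<close>. It is only used to evaluate expressions in local
  coordinates that, by the tensor transformation laws below, do not depend on the chart.\<close>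

definition chart_at :: "('m, 'n::finite) chart set \<Rightarrow> 'm \<Rightarrow> ('m, 'n) chart" where
  "chart_at A p = (SOME c. c \<in> A \<and> p \<in> chart_dom c)"


section \<open>Riemannian metrics\<close>

text \<open>Tensor fields are given by their components in each chart of the atlas, related by the
  tensor transformation law. Here \<open>g c p\<close> is the Gram matrix of the metric at \<open>p\<close> in the
  coordinate frame of the chart \<open>c\<close>.\<close>

type_synonym ('m, 'n) metric_components = "('m, 'n) chart \<Rightarrow> 'm \<Rightarrow> real^'n^'n"

definition riemannian_metric ::
  "('m, 'n::finite) chart set \<Rightarrow> ('m, 'n) metric_components \<Rightarrow> bool" where
  "riemannian_metric A g \<longleftrightarrow>
     (\<forall>c\<in>A. \<forall>p\<in>chart_dom c. transpose (g c p) = g c p \<and> (\<forall>v. v \<noteq> 0 \<longrightarrow> v \<bullet> (g c p *v v) > 0)) \<and>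
     (\<forall>c\<in>A. smooth_on (chart_map c ` chart_dom c) (\<lambda>y. g c (chart_inv c y))) \<and>
     (\<forall>c\<in>A. \<forall>d\<in>A. \<forall>p\<in>chart_dom c \<inter> chart_dom d.
        g c p = transpose (jacobian c d p) ** g d p ** jacobian c d p)"

definition riemannian_manifold ::
  "('m::{second_countable_topology,t2_space}, 'n::finite) chart set \<Rightarrow>
   ('m, 'n) metric_components \<Rightarrow> bool" where
  "riemannian_manifold A g \<longleftrightarrow> smooth_atlas A \<and> riemannian_metric A g"


subsection \<open>Distance and completeness\<close>

definition C1_curve_on ::
  "('m::topological_space, 'n::finite) chart set \<Rightarrow> real \<Rightarrow> real \<Rightarrow> (real \<Rightarrow> 'm) \<Rightarrow> bool" where
  "C1_curve_on A a b \<gamma> \<longleftrightarrow>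
     continuous_on {a..b} \<gamma> \<and>
     (\<forall>c\<in>A. \<exists>D. continuous_on {t\<in>{a..b}. \<gamma> t \<in> chart_dom c} D \<and>
        (\<forall>t\<in>{a..b}. \<gamma> t \<in> chart_dom c \<longrightarrow>
           ((chart_map c \<circ> \<gamma>) has_vector_derivative D t) (at t within {a..b})))"

definition piecewise_C1_curve ::
  "('m::topological_space, 'n::finite) chart set \<Rightarrow> (real \<Rightarrow> 'm) \<Rightarrow> bool" where
  "piecewise_C1_curve A \<gamma> \<longleftrightarrow>
     (\<exists>m (s :: nat \<Rightarrow> real). s 0 = 0 \<and> s m = 1 \<and>
        (\<forall>i<m. s i < s (Suc i) \<and> C1_curve_on A (s i) (s (Suc i)) \<gamma>))"

definition curve_speed ::
  "('m, 'n::finite) chart set \<Rightarrow> ('m, 'n) metric_components \<Rightarrow> (real \<Rightarrow> 'm) \<Rightarrow> real \<Rightarrow> real" where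
  "curve_speed A g \<gamma> t =
     (let c = chart_at A (\<gamma> t); v = vector_derivative (chart_map c \<circ> \<gamma>) (at t)
      in sqrt (v \<bullet> (g c (\<gamma> t) *v v)))"

definition curve_length ::
  "('m, 'n::finite) chart set \<Rightarrow> ('m, 'n) metric_components \<Rightarrow> (real \<Rightarrow> 'm) \<Rightarrow> ennreal" where
  "curve_length A g \<gamma> = (\<integral>\<^sup>+t\<in>{0..1}. ennreal (curve_speed A g \<gamma> t) \<partial>lborel)"

text \<open>The distance is \<open>\<infinity>\<close> between points of different connected components.\<close>

definition riemannian_dist ::
  "('m::topological_space, 'n::finite) chart set \<Rightarrow> ('m, 'n) metric_components \<Rightarrow>
   'm \<Rightarrow> 'm \<Rightarrow> ennreal" where
  "riemannian_dist A g x y =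
     (INF \<gamma> \<in> {\<gamma>. piecewise_C1_curve A \<gamma> \<and> \<gamma> 0 = x \<and> \<gamma> 1 = y}. curve_length A g \<gamma>)"

definition geodesic_ball ::
  "('m::topological_space, 'n::finite) chart set \<Rightarrow> ('m, 'n) metric_components \<Rightarrow>
   'm \<Rightarrow> real \<Rightarrow> 'm set" where
  "geodesic_ball A g x r = {y. riemannian_dist A g x y < ennreal r}"

definition complete_manifold ::
  "('m::topological_space, 'n::finite) chart set \<Rightarrow> ('m, 'n) metric_components \<Rightarrow> bool" where
  "complete_manifold A g \<longleftrightarrow>
     (\<forall>\<sigma> :: nat \<Rightarrow> 'm.
        (\<forall>e>0. \<exists>N. \<forall>m\<ge>N. \<forall>n\<ge>N. riemannian_dist A g (\<sigma> m) (\<sigma> n) < ennreal e) \<longrightarrow>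
        (\<exists>x. (\<lambda>n. riemannian_dist A g (\<sigma> n) x) \<longlonglongrightarrow> 0))"


subsection \<open>Volume\<close>

text \<open>The unique Borel measure given by \<open>sqrt (det g) dx\<close> in every chart. It is determined by
  these conditions since countably many charts cover the manifold.\<close>

definition volume_measure ::
  "('m::{second_countable_topology,t2_space}, 'n::finite) chart set \<Rightarrow>
   ('m, 'n) metric_components \<Rightarrow> 'm measure" where
  "volume_measure A g =
     (THE \<mu>. sets \<mu> = sets borel \<and>
        (\<forall>c\<in>A. \<forall>S\<in>sets borel. S \<subseteq> chart_dom c \<longrightarrow>
           emeasure \<mu> S =
             (\<integral>\<^sup>+y\<in>chart_map c ` S. ennreal (sqrt (det (g c (chart_inv c y)))) \<partial>lborel)))"


section \<open>Differential forms\<close>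

text \<open>For tangent vectors \<open>vs = [v\<^sub>1, \<dots>, v\<^sub>k]\<close> at \<open>p\<close>, written in the coordinate frame of \<open>c\<close>,
  \<open>\<omega> c p vs\<close> is the value of the form. Only lists of length \<open>k\<close> matter.\<close>

type_synonym ('m, 'n) form_components = "('m, 'n) chart \<Rightarrow> 'm \<Rightarrow> (real^'n) list \<Rightarrow> real"

definition alternating_form :: "nat \<Rightarrow> ((real^'n::finite) list \<Rightarrow> real) \<Rightarrow> bool" where
  "alternating_form k \<alpha> \<longleftrightarrow>
     (\<forall>vs. length vs = k \<longrightarrow>
        (\<forall>i<k. linear (\<lambda>v. \<alpha> (vs[i := v]))) \<and>
        (\<forall>j<k. \<forall>i<j. vs ! i = vs ! j \<longrightarrow> \<alpha> vs = 0))"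

definition smooth_form ::
  "('m, 'n::finite) chart set \<Rightarrow> nat \<Rightarrow> ('m, 'n) form_components \<Rightarrow> bool" where
  "smooth_form A k \<omega> \<longleftrightarrow>
     (\<forall>c\<in>A. \<forall>p\<in>chart_dom c. alternating_form k (\<omega> c p)) \<and>
     (\<forall>c\<in>A. \<forall>vs. length vs = k \<longrightarrow>
        smooth_on (chart_map c ` chart_dom c) (\<lambda>y. \<omega> c (chart_inv c y) vs)) \<and>
     (\<forall>c\<in>A. \<forall>d\<in>A. \<forall>p\<in>chart_dom c \<inter> chart_dom d. \<forall>vs. length vs = k \<longrightarrow>
        \<omega> c p vs = \<omega> d p (map (\<lambda>v. jacobian c d p *v v) vs))"

text \<open>In coordinates, \<open>|\<omega>|\<^sup>2\<close> is \<open>1/k!\<close> times the full contraction of \<open>\<omega> \<otimes> \<omega>\<close> with the inverse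
  metric; the factor \<open>1/k!\<close> makes it the sum of \<open>\<omega>(e\<^sub>i\<^sub>1, \<dots>, e\<^sub>i\<^sub>k)\<^sup>2\<close> over \<open>i\<^sub>1 < \<dots> < i\<^sub>k\<close> for an
  orthonormal frame \<open>e\<close>.\<close>

definition form_norm ::
  "('m, 'n::finite) chart set \<Rightarrow> ('m, 'n) metric_components \<Rightarrow> nat \<Rightarrow>
   ('m, 'n) form_components \<Rightarrow> 'm \<Rightarrow> real" where
  "form_norm A g k \<omega> p =
     (let c = chart_at A p; G = matrix_inv (g c p); I = {is :: 'n list. length is = k};
          \<omega>\<^sub>I = (\<lambda>is. \<omega> c p (map (\<lambda>i. axis i 1) is))
      in sqrt ((1 / fact k) *
           (\<Sum>is\<in>I. \<Sum>js\<in>I. (\<Prod>l<k. G $ (is ! l) $ (js ! l)) * \<omega>\<^sub>I is * \<omega>\<^sub>I js)))"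


section \<open>Moderate growth\<close>

text \<open>The class of growth functions. Elements of \<open>growth_fns_from a\<close> are regarded as functions
  on \<open>[a, \<infinity>)\<close>. That the integral of \<open>1 / (r \<psi>(r))\<close> over \<open>[a, \<infinity>)\<close> is infinite means divergence
  at infinity: it is required of all tails, since a divergence caused only by a singularity at
  a finite point (such as that of \<open>1/r\<close> at \<open>r = 0\<close> if \<open>a = 0\<close>) is not intended.\<close>

definition growth_fns_from :: "real \<Rightarrow> (real \<Rightarrow> real) set" where
  "growth_fns_from a =
     {\<psi>. \<psi> \<in> borel_measurable (lebesgue_on {a..}) \<and> (\<forall>r\<ge>a. \<psi> r > 0) \<and>
        (\<forall>b\<ge>a. b > 0 \<longrightarrow> (\<integral>\<^sup>+r\<in>{b..}. ennreal (1 / (r * \<psi> r)) \<partial>lebesgue) = \<infinity>)}"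

definition growth_fns :: "(real \<Rightarrow> real) set" where
  "growth_fns = (\<Union>a\<in>{0..}. growth_fns_from a)"

text \<open>\<open>2\<close>-moderate growth for \<open>q = 2\<close>, with respect to the given \<open>x0\<close> and \<open>\<psi>\<close>. On a complete
  manifold the geodesic balls are relatively compact, so for smooth \<open>\<omega>\<close> the integrals are
  those of integrable functions.\<close>

definition moderate_growth_wrt ::
  "('m::{second_countable_topology,t2_space}, 'n::finite) chart set \<Rightarrow>
   ('m, 'n) metric_components \<Rightarrow> nat \<Rightarrow> ('m, 'n) form_components \<Rightarrow>
   'm \<Rightarrow> (real \<Rightarrow> real) \<Rightarrow> bool" where
  "moderate_growth_wrt A g k \<omega> x0 \<psi> \<longleftrightarrow>
     \<psi> \<in> growth_fns \<and>
     Limsup at_top (\<lambda>r. ereal (1 / (r\<^sup>2 * \<psi> r) *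
       (LINT x:geodesic_ball A g x0 r|volume_measure A g. (form_norm A g k \<omega> x)\<^sup>2))) < \<infinity>"

end

theory Submission
  imports Defs "HOL-Real_Asymp.Real_Asymp"
begin

text \<open>A function \<open>\<psi>\<close> of the class \<open>\<F>\<close> with \<open>\<psi>(\<rho>) / \<rho> powr s \<longlongrightarrow> L\<close> for some \<open>s > 0\<close> must
  have \<open>L = 0\<close>: if \<open>L > 0\<close>, then \<open>1 / (r \<psi>(r))\<close> is eventually at most \<open>(2 / L) r powr (- s - 1)\<close>, which is
  integrable at infinity. With \<open>s = \<lambda> - 2\<close>, the energy in the ball of radius \<open>\<rho>\<close> is therefore
  \<open>O(\<rho>\<^sup>2 \<psi>(\<rho>)) = o(\<rho>\<^sup>\<lambda>)\<close>. A decreasing positive \<open>\<psi>\<close> is bounded, so \<open>\<psi>(\<rho>) = o(\<rho>\<^sup>s)\<close> anyway.\<close>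

lemma growth_fns_from_tendsto_0:
  assumes "\<psi> \<in> growth_fns_from a" "s > 0"
    and lim: "((\<lambda>\<rho>. \<psi> \<rho> / \<rho> powr s) \<longlongrightarrow> L) at_top"
  shows "L = 0"
proof (rule ccontr)
  assume "L \<noteq> 0"
  have pos: "\<psi> r > 0" if "r \<ge> a" for r
    using assms(1) that by (simp add: growth_fns_from_def)
  have "eventually (\<lambda>\<rho>. \<psi> \<rho> / \<rho> powr s \<ge> 0) at_top"
    using eventually_ge_at_top[of a] by eventually_elim (simp add: pos less_imp_le)
  then have "L \<ge> 0"
    by (rule tendsto_lowerbound[OF lim]) simp
  with \<open>L \<noteq> 0\<close> have "L > 0" by simp
  \<comment> \<open>Half the limit serves as a positive lower bound for the quotient; it is the
    source of the constant \<open>2 / L\<close> below.\<close>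
  then have "eventually (\<lambda>\<rho>. \<psi> \<rho> / \<rho> powr s > L / 2) at_top"
    by (intro order_tendstoD[OF lim]) simp
  then obtain c where c: "\<And>\<rho>. \<rho> \<ge> c \<Longrightarrow> \<psi> \<rho> / \<rho> powr s > L / 2"
    by (auto simp: eventually_at_top_linorder)
  \<comment> \<open>Beyond \<open>a\<close> the function is positive, beyond \<open>c\<close> the
    lower bound holds, and the 1 keeps the tail away from the singularity of the integrand at
    0.\<close>
  define b where "b = max 1 (max a c)"
  have b: "b \<ge> 1" "b \<ge> a" "b \<ge> c" by (auto simp: b_def)
  have bound: "1 / (r * \<psi> r) \<le> 2 / L * r powr (- s - 1)" if "r \<ge> b" for r
  proof -
    have r: "r > 0" "\<psi> r > 0" "L / 2 * r powr s < \<psi> r"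
      using that b c[of r] pos[of r] by (auto simp: field_simps)
    have "1 / (r * \<psi> r) \<le> 1 / (r * (L / 2 * r powr s))"
      using r \<open>L > 0\<close> by (intro divide_left_mono mult_left_mono mult_pos_pos) auto
    also have "\<dots> = 2 / L * r powr (- s - 1)"
      using r \<open>L > 0\<close> by (simp add: powr_diff powr_minus field_simps)
    finally show ?thesis .
  qed
  \<comment> \<open>The left side is infinite by membership in the growth class, so a finite
    majorant gives the contradiction.\<close>
  have "(\<integral>\<^sup>+r\<in>{b..}. ennreal (1 / (r * \<psi> r)) \<partial>lebesgue)
      \<le> (\<integral>\<^sup>+r. ennreal (2 / L) * (ennreal (r powr (- s - 1)) * indicator {b..} r) \<partial>lebesgue)"
    using bound \<open>L > 0\<close>
    by (intro nn_integral_mono) (auto simp: indicator_def ennreal_mult'[symmetric] intro!: ennreal_leI)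
  also have "\<dots> = ennreal (2 / L) * (\<integral>\<^sup>+r\<in>{b..}. ennreal (r powr (- s - 1)) \<partial>lborel)"
    unfolding nn_integral_completion by (rule nn_integral_cmult) simp
  \<comment> \<open>Since \<open>s > 0\<close>, the antiderivative
    \<open>- (r powr (- s)) / s\<close> vanishes at infinity.\<close>
  also have "(\<integral>\<^sup>+r\<in>{b..}. ennreal (r powr (- s - 1)) \<partial>lborel) = ennreal (b powr (- s) / s)"
    using has_integral_powr_to_inf[of "- s - 1" b] b \<open>s > 0\<close>
    by (intro nn_integral_has_integral_lebesgue') auto
  also have "ennreal (2 / L) * ennreal (b powr (- s) / s) < \<infinity>"
    by (simp add: ennreal_mult_less_top)
  finally show False
    using assms(1) b by (auto simp: growth_fns_from_def)
qed

text \<open>The values on \<open>{a..}\<close> lie between 0 and \<open>\<psi> a\<close>, while a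
  positive power tends to infinity.\<close>

lemma antimono_on_smallo_powr:
  fixes \<psi> :: "real \<Rightarrow> real"
  assumes "antimono_on {a..} \<psi>" "\<And>r. r \<ge> a \<Longrightarrow> \<psi> r > 0" "s > 0"
  shows "\<psi> \<in> o[at_top](\<lambda>\<rho>. \<rho> powr s)"
proof -
  have "eventually (\<lambda>\<rho>. norm (\<psi> \<rho>) \<le> \<psi> a * norm (1::real)) at_top"
    using eventually_ge_at_top[of a]
  proof eventually_elim
    case (elim \<rho>)
    then show ?case
      using assms(2)[of \<rho>] monotone_onD[OF assms(1), of a \<rho>] by simp
  qed
  then have "\<psi> \<in> O[at_top](\<lambda>_. 1)" by (rule bigoI)
  also have "(\<lambda>_. 1) \<in> o[at_top](\<lambda>\<rho>::real. \<rho> powr s)"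
    using assms(3) by real_asymp
  finally show ?thesis .
qed

text \<open>A limit superior below infinity lies below some real \<open>C\<close>, which then
  eventually bounds the ratio; the sign conditions allow clearing the denominator and dropping the
  norms.\<close>

lemma Limsup_ratio_imp_bigo:
  fixes F h :: "real \<Rightarrow> real"
  assumes "Limsup at_top (\<lambda>r. ereal (1 / h r * F r)) < \<infinity>"
    and "\<And>r. F r \<ge> 0" and "eventually (\<lambda>r. h r > 0) at_top"
  shows "F \<in> O[at_top](h)"
proof -
  obtain C where "Limsup at_top (\<lambda>r. ereal (1 / h r * F r)) < ereal C"
    using ereal_dense2[OF assms(1)] by auto
  then have "eventually (\<lambda>r. ereal (1 / h r * F r) < ereal C) at_top"
    by (rule Limsup_lessD)
  with assms(3) have "eventually (\<lambda>r. norm (F r) \<le> C * norm (h r)) at_top"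
    by eventually_elim (use assms(2) in \<open>auto simp: field_simps\<close>)
  then show ?thesis by (rule bigoI)
qed

text \<open>Common core of both claims of the theorem, which differ only in how they bring
  \<open>\<psi>\<close> below \<open>\<rho> powr (lam - 2)\<close>.\<close>

lemma moderate_growth_wrt_imp_smallo:
  fixes g :: "('m::{second_countable_topology,t2_space}, 'n::finite) metric_components"
  assumes "moderate_growth_wrt A g k \<omega> x0 \<psi>"
    and small: "\<psi> \<in> o[at_top](\<lambda>\<rho>. \<rho> powr (lam - 2))"
  shows "(\<lambda>\<rho>. LINT x:geodesic_ball A g x0 \<rho>|volume_measure A g. (form_norm A g k \<omega> x)\<^sup>2 / 2)
           \<in> o[at_top](\<lambda>\<rho>. \<rho> powr lam)"
proof -
  define F where
    "F \<rho> = (LINT x:geodesic_ball A g x0 \<rho>|volume_measure A g. (form_norm A g k \<omega> x)\<^sup>2)" for \<rho>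
  obtain a where "\<psi> \<in> growth_fns_from a"
    using assms(1) by (auto simp: moderate_growth_wrt_def growth_fns_def)
  then have pos: "\<psi> r > 0" if "r \<ge> a" for r
    using that by (simp add: growth_fns_from_def)
  have "F \<in> O[at_top](\<lambda>r. r\<^sup>2 * \<psi> r)"
  proof (rule Limsup_ratio_imp_bigo)
    show "Limsup at_top (\<lambda>r. ereal (1 / (r\<^sup>2 * \<psi> r) * F r)) < \<infinity>"
      using assms(1) by (simp add: moderate_growth_wrt_def F_def)
    \<comment> \<open>The integrand is nonnegative, and a non-integrable function has Bochner
      integral 0 by default.\<close>
    show "F r \<ge> 0" for r
      unfolding F_def set_lebesgue_integral_def by (intro integral_nonneg_AE) auto
    show "eventually (\<lambda>r. r\<^sup>2 * \<psi> r > 0) at_top"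
      using eventually_ge_at_top[of a] eventually_gt_at_top[of 0]
      by eventually_elim (simp add: pos)
  qed
  also have "(\<lambda>r. r\<^sup>2 * \<psi> r) \<in> o[at_top](\<lambda>r. r\<^sup>2 * r powr (lam - 2))"
    using small by (intro landau_o.big_small_mult) auto
  also have "(\<lambda>r. r\<^sup>2 * r powr (lam - 2)) \<in> \<Theta>[at_top](\<lambda>r. r powr lam)"
  proof (rule bigthetaI_cong)
    show "eventually (\<lambda>r::real. r\<^sup>2 * r powr (lam - 2) = r powr lam) at_top"
      using eventually_gt_at_top[of 0]
      by eventually_elim (simp add: powr_diff)
  qed
  \<comment> \<open>The constant factor 1/2, absent from \<open>F\<close>, does not affect the order
    of growth.\<close>
  finally show ?thesis
    by (simp add: F_def[abs_def])
qed

theorem theorem9p1: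
  fixes A :: "('m::{second_countable_topology,t2_space}, 'n::finite) chart set"
    and g :: "('m, 'n) metric_components"
    and \<omega> :: "('m, 'n) form_components"
    and k :: nat and lam :: real
  assumes "riemannian_manifold A g" and "complete_manifold A g"
    and "\<not> compact (UNIV :: 'm set)"
    and "smooth_form A k \<omega>"
    and "lam > 2"
  shows "(\<forall>x0 \<psi>. moderate_growth_wrt A g k \<omega> x0 \<psi> \<and>
           (\<exists>L::real. ((\<lambda>\<rho>. \<psi> \<rho> / \<rho> powr (lam - 2)) \<longlongrightarrow> L) at_top) \<longrightarrow>
           (\<lambda>\<rho>. LINT x:geodesic_ball A g x0 \<rho>|volume_measure A g. (form_norm A g k \<omega> x)\<^sup>2 / 2)
             \<in> o[at_top](\<lambda>\<rho>. \<rho> powr lam)) \<and>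
         (\<forall>x0 \<psi>. moderate_growth_wrt A g k \<omega> x0 \<psi> \<and>
           (\<exists>a\<ge>0. \<psi> \<in> growth_fns_from a \<and> continuous_on {a..} \<psi> \<and> antimono_on {a..} \<psi>) \<longrightarrow>
           (\<lambda>\<rho>. LINT x:geodesic_ball A g x0 \<rho>|volume_measure A g. (form_norm A g k \<omega> x)\<^sup>2 / 2)
             \<in> o[at_top](\<lambda>\<rho>. \<rho> powr lam))"
proof (intro conjI allI impI; elim conjE exE)
  fix x0 \<psi> L
  assume mg: "moderate_growth_wrt A g k \<omega> x0 \<psi>"
    and lim: "((\<lambda>\<rho>. \<psi> \<rho> / \<rho> powr (lam - 2)) \<longlongrightarrow> L) at_top"
  obtain a where "\<psi> \<in> growth_fns_from a"
    using mg by (auto simp: moderate_growth_wrt_def growth_fns_def)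
  \<comment> \<open>The exponent \<open>lam - 2\<close> is positive, so divergence of the integral
    forces \<open>L = 0\<close>: the finite limit improves to little-o.\<close>
  with lim \<open>lam > 2\<close> have "((\<lambda>\<rho>. \<psi> \<rho> / \<rho> powr (lam - 2)) \<longlongrightarrow> 0) at_top"
    using growth_fns_from_tendsto_0[of \<psi> a "lam - 2" L] by simp
  moreover have "eventually (\<lambda>\<rho>. \<rho> powr (lam - 2) \<noteq> 0) at_top"
    using eventually_gt_at_top[of 0] by eventually_elim simp
  ultimately have "\<psi> \<in> o[at_top](\<lambda>\<rho>. \<rho> powr (lam - 2))"
    by (rule smalloI_tendsto)
  with mg show "(\<lambda>\<rho>. LINT x:geodesic_ball A g x0 \<rho>|volume_measure A g. (form_norm A g k \<omega> x)\<^sup>2 / 2)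
      \<in> o[at_top](\<lambda>\<rho>. \<rho> powr lam)"
    by (rule moderate_growth_wrt_imp_smallo)
next
  fix x0 \<psi> a
  assume mg: "moderate_growth_wrt A g k \<omega> x0 \<psi>"
    and \<psi>: "\<psi> \<in> growth_fns_from a" "antimono_on {a..} \<psi>"
  have "\<psi> \<in> o[at_top](\<lambda>\<rho>. \<rho> powr (lam - 2))"
    using \<psi> \<open>lam > 2\<close> by (intro antimono_on_smallo_powr) (auto simp: growth_fns_from_def)
  with mg show "(\<lambda>\<rho>. LINT x:geodesic_ball A g x0 \<rho>|volume_measure A g. (form_norm A g k \<omega> x)\<^sup>2 / 2)
      \<in> o[at_top](\<lambda>\<rho>. \<rho> powr lam)"
    by (rule moderate_growth_wrt_imp_smallo)
qed

end
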